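(* Let $R$ be a ring and $\alpha:R\to R$ a ring homomorphism. The skew formal power series ring $R[[x;\alpha]]$ is $W\Delta U$ if and only if $R$ is $W\Delta U$.
   Context: Rings are associative with identity (and homomorphisms preserve it), not necessarily commutative. $R[[x;\alpha]]$ is the ring of formal power series $\sum_{i\ge 0} r_i x^i$ with $r_i\in R$ and multiplication determined by $xr=\alpha(r)x$ for all $r\in R$. $U(S)$ is the group of units of a ring $S$. $\Delta(S)=\{r\in S : r+u\in U(S)\text{ for all }u\in U(S)\}$; equivalently $\Delta(S)=J(T)$, where $T$ is the subring of $S$ generated by $U(S)$ and $J$ denotes the Jacobson radical. $S$ is $W\Delta U$ if $U(S)=\pm 1+\Delta(S)$, i.e. every unit of $S$ has the form $1+d$ or $-1+d$ with $d\in\Delta(S)$. *)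

theory Defs
  imports "HOL-Algebra.RingHom"
begin

text \<open>
  The series \<open>r\<^sub>0 + r\<^sub>1 x + r\<^sub>2 x\<^sup>2 + \<dots>\<close> is represented by its sequence of coefficients
  \<open>r :: nat \<Rightarrow> 'a\<close>. The rule \<open>x r = \<alpha>(r) x\<close> gives
  \<open>(r x\<^sup>i) (s x\<^sup>j) = r \<alpha>\<^sup>i(s) x\<^sup>i\<^sup>+\<^sup>j\<close>, whence the formula for the product.
\<close>

definition skew_fps :: "('a, 'm) ring_scheme \<Rightarrow> ('a \<Rightarrow> 'a) \<Rightarrow> (nat \<Rightarrow> 'a) ring"
  where "skew_fps R \<alpha> =
    \<lparr>carrier = UNIV \<rightarrow> carrier R,
     mult = (\<lambda>f g n. \<Oplus>\<^bsub>R\<^esub>i\<in>{..n}. f i \<otimes>\<^bsub>R\<^esub> (\<alpha> ^^ i) (g (n - i))),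
     one = (\<lambda>n. if n = 0 then \<one>\<^bsub>R\<^esub> else \<zero>\<^bsub>R\<^esub>),
     zero = (\<lambda>n. \<zero>\<^bsub>R\<^esub>),
     add = (\<lambda>f g n. f n \<oplus>\<^bsub>R\<^esub> g n)\<rparr>"

definition skew_fps_const :: "('a, 'm) ring_scheme \<Rightarrow> 'a \<Rightarrow> nat \<Rightarrow> 'a"
  where "skew_fps_const R r = (\<lambda>n. if n = 0 then r else \<zero>\<^bsub>R\<^esub>)"

definition skew_fps_X :: "('a, 'm) ring_scheme \<Rightarrow> nat \<Rightarrow> 'a"
  where "skew_fps_X R = (\<lambda>n. if n = 1 then \<one>\<^bsub>R\<^esub> else \<zero>\<^bsub>R\<^esub>)"


definition Delta :: "('a, 'm) ring_scheme \<Rightarrow> 'a set"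
  where "Delta S = {r \<in> carrier S. \<forall>u\<in>Units S. r \<oplus>\<^bsub>S\<^esub> u \<in> Units S}"

definition WDeltaU :: "('a, 'm) ring_scheme \<Rightarrow> bool"
  where "WDeltaU S \<longleftrightarrow> Units S = {\<one>\<^bsub>S\<^esub>, \<ominus>\<^bsub>S\<^esub> \<one>\<^bsub>S\<^esub>} <+>\<^bsub>S\<^esub> Delta S"


context ring
begin

lemma hom_funpow:
  assumes "\<alpha> \<in> ring_hom R R" shows "(\<alpha> ^^ n) \<in> ring_hom R R"
proof (induction n)
  case 0 then show ?case by (auto intro: ring_hom_memI)
next
  case (Suc n)
  then show ?case using assms
    by (auto intro!: ring_hom_memI simp: ring_hom_closed ring_hom_mult ring_hom_add ring_hom_one)
qed

lemma hom_zero_finsum: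
  assumes h: "h \<in> ring_hom R R"
  shows "h \<zero> = \<zero>"
    and "f \<in> A \<rightarrow> carrier R \<Longrightarrow> h (\<Oplus>i\<in>A. f i) = (\<Oplus>i\<in>A. h (f i))"
proof -
  interpret H: ring_hom_ring R R h using h by unfold_locales
  show "h \<zero> = \<zero>" by (rule H.hom_zero)
  show "f \<in> A \<rightarrow> carrier R \<Longrightarrow> h (\<Oplus>i\<in>A. f i) = (\<Oplus>i\<in>A. h (f i))"
    by (induction A rule: infinite_finite_induct) (auto simp: Pi_def)
qed

lemma skew_fps_assoc_aux:
  assumes a: "\<And>i. a i \<in> carrier R" and b: "\<And>i j. b i j \<in> carrier R"
    and c: "\<And>i j. c i j \<in> carrier R"
  shows "k \<le> (n::nat) \<Longrightarrow>
      (\<Oplus>j\<in>{..k}. (\<Oplus>i\<in>{..j}. a i \<otimes> b i (j - i)) \<otimes> c j (n - j)) =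
      (\<Oplus>j\<in>{..k}. a j \<otimes> (\<Oplus>i\<in>{..k-j}. b j i \<otimes> c (j + i) (n - j - i)))"
proof (induction k)
  case 0 then show ?case by (simp add: m_assoc a b c)
next
  case (Suc k)
  have s: "(\<Oplus>i\<in>{..Suc k - j}. b j i \<otimes> c (j + i) (n - j - i)) =
      b j (Suc k - j) \<otimes> c (Suc k) (n - Suc k) \<oplus>
      (\<Oplus>i\<in>{..k-j}. b j i \<otimes> c (j + i) (n - j - i))" if "j \<le> k" for j
    using that Suc.prems by (simp add: Suc_diff_le Pi_def b c)
  have "(\<Oplus>j\<in>{..k}. a j \<otimes> (\<Oplus>i\<in>{..Suc k-j}. b j i \<otimes> c (j + i) (n - j - i))) =
      (\<Oplus>j\<in>{..k}. a j \<otimes> b j (Suc k - j) \<otimes> c (Suc k) (n - Suc k) \<oplus>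
        a j \<otimes> (\<Oplus>i\<in>{..k-j}. b j i \<otimes> c (j + i) (n - j - i)))"
    by (rule finsum_cong) (auto simp: s[simplified] a b c r_distr m_assoc Pi_def simp_implies_def)
  also have "\<dots> = (\<Oplus>j\<in>{..k}. a j \<otimes> b j (Suc k - j)) \<otimes> c (Suc k) (n - Suc k) \<oplus>
      (\<Oplus>j\<in>{..k}. a j \<otimes> (\<Oplus>i\<in>{..k-j}. b j i \<otimes> c (j + i) (n - j - i)))"
    by (simp add: finsum_addf finsum_ldistr a b c Pi_def)
  finally show ?case
    using Suc by (simp add: Pi_def a b c a_ac l_distr m_assoc)
qed

lemma skew_fps_finsum_single:
  assumes "k \<le> n" "f k \<in> carrier R" "\<And>i. i \<le> n \<Longrightarrow> i \<noteq> k \<Longrightarrow> f i = \<zero>"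
  shows "(\<Oplus>i\<in>{..n::nat}. f i) = f k"
proof -
  have "(\<Oplus>i\<in>{..n}. f i) = (\<Oplus>i\<in>{..n}. if k = i then f k else \<zero>)"
    by (rule finsum_cong') (use assms in auto)
  also have "\<dots> = f k"
    using finsum_singleton[of k "{..n}" "\<lambda>i. f k"] assms by simp
  finally show ?thesis .
qed

theorem ring_skew_fps:
  assumes \<alpha>: "\<alpha> \<in> ring_hom R R"
  shows "ring (skew_fps R \<alpha>)"
proof (rule ringI)
  have cl: "(\<alpha> ^^ i) r \<in> carrier R" if "r \<in> carrier R" for r i
    using ring_hom_closed[OF hom_funpow[OF \<alpha>] that] .
  note homs = cl ring_hom_mult[OF hom_funpow[OF \<alpha>]] ring_hom_add[OF hom_funpow[OF \<alpha>]]
    ring_hom_one[OF hom_funpow[OF \<alpha>]] hom_zero_finsum[OF hom_funpow[OF \<alpha>]]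
  show "abelian_group (skew_fps R \<alpha>)"
  proof (rule abelian_groupI)
    fix f assume "f \<in> carrier (skew_fps R \<alpha>)"
    then show "\<exists>g\<in>carrier (skew_fps R \<alpha>). g \<oplus>\<^bsub>skew_fps R \<alpha>\<^esub> f = \<zero>\<^bsub>skew_fps R \<alpha>\<^esub>"
      by (intro bexI[where x = "\<lambda>n. \<ominus> f n"]) (auto simp: skew_fps_def l_neg Pi_def)
  qed (auto simp: skew_fps_def Pi_def fun_eq_iff a_ac)
  show "monoid (skew_fps R \<alpha>)"
  proof (rule monoidI)
    fix f g h
    assume "f \<in> carrier (skew_fps R \<alpha>)" "g \<in> carrier (skew_fps R \<alpha>)" "h \<in> carrier (skew_fps R \<alpha>)"
    then have c: "\<And>i. f i \<in> carrier R" "\<And>i. g i \<in> carrier R" "\<And>i. h i \<in> carrier R"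
      by (auto simp: skew_fps_def)
    have "(f \<otimes>\<^bsub>skew_fps R \<alpha>\<^esub> g \<otimes>\<^bsub>skew_fps R \<alpha>\<^esub> h) n =
        (f \<otimes>\<^bsub>skew_fps R \<alpha>\<^esub> (g \<otimes>\<^bsub>skew_fps R \<alpha>\<^esub> h)) n" for n
      using skew_fps_assoc_aux[of f "\<lambda>i j. (\<alpha> ^^ i) (g j)" "\<lambda>i j. (\<alpha> ^^ i) (h j)" n n]
      by (simp add: skew_fps_def homs c Pi_def funpow_add)
    then show "f \<otimes>\<^bsub>skew_fps R \<alpha>\<^esub> g \<otimes>\<^bsub>skew_fps R \<alpha>\<^esub> h =
        f \<otimes>\<^bsub>skew_fps R \<alpha>\<^esub> (g \<otimes>\<^bsub>skew_fps R \<alpha>\<^esub> h)" ..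
  next
    fix f assume "f \<in> carrier (skew_fps R \<alpha>)"
    then have c: "\<And>i. f i \<in> carrier R" by (auto simp: skew_fps_def)
    have "(\<one>\<^bsub>skew_fps R \<alpha>\<^esub> \<otimes>\<^bsub>skew_fps R \<alpha>\<^esub> f) n = f n" for n
      using skew_fps_finsum_single[of 0 n "\<lambda>i. (if i = 0 then \<one> else \<zero>) \<otimes> (\<alpha> ^^ i) (f (n - i))"]
      by (simp add: skew_fps_def c homs)
    then show "\<one>\<^bsub>skew_fps R \<alpha>\<^esub> \<otimes>\<^bsub>skew_fps R \<alpha>\<^esub> f = f" ..
    have "(f \<otimes>\<^bsub>skew_fps R \<alpha>\<^esub> \<one>\<^bsub>skew_fps R \<alpha>\<^esub>) n = f n" for n
      using skew_fps_finsum_single[of n n "\<lambda>i. f i \<otimes> (\<alpha> ^^ i) (if n - i = 0 then \<one> else \<zero>)"]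
      by (simp add: skew_fps_def c homs)
    then show "f \<otimes>\<^bsub>skew_fps R \<alpha>\<^esub> \<one>\<^bsub>skew_fps R \<alpha>\<^esub> = f" ..
  qed (auto simp: skew_fps_def Pi_def homs)
next
  have cl: "(\<alpha> ^^ i) r \<in> carrier R" if "r \<in> carrier R" for r i
    using ring_hom_closed[OF hom_funpow[OF \<alpha>] that] .
  note homs = cl ring_hom_add[OF hom_funpow[OF \<alpha>]]
  fix f g h
  assume "f \<in> carrier (skew_fps R \<alpha>)" "g \<in> carrier (skew_fps R \<alpha>)" "h \<in> carrier (skew_fps R \<alpha>)"
  then have c: "\<And>i. f i \<in> carrier R" "\<And>i. g i \<in> carrier R" "\<And>i. h i \<in> carrier R"
    by (auto simp: skew_fps_def)
  show "(f \<oplus>\<^bsub>skew_fps R \<alpha>\<^esub> g) \<otimes>\<^bsub>skew_fps R \<alpha>\<^esub> h =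
      f \<otimes>\<^bsub>skew_fps R \<alpha>\<^esub> h \<oplus>\<^bsub>skew_fps R \<alpha>\<^esub> g \<otimes>\<^bsub>skew_fps R \<alpha>\<^esub> h"
    by (simp add: skew_fps_def c homs l_distr finsum_addf Pi_def)
  show "h \<otimes>\<^bsub>skew_fps R \<alpha>\<^esub> (f \<oplus>\<^bsub>skew_fps R \<alpha>\<^esub> g) =
      h \<otimes>\<^bsub>skew_fps R \<alpha>\<^esub> f \<oplus>\<^bsub>skew_fps R \<alpha>\<^esub> h \<otimes>\<^bsub>skew_fps R \<alpha>\<^esub> g"
    by (simp add: skew_fps_def c homs r_distr finsum_addf Pi_def)
qed

theorem skew_fps_X_const:
  assumes \<alpha>: "\<alpha> \<in> ring_hom R R" and r: "r \<in> carrier R"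
  shows "skew_fps_X R \<otimes>\<^bsub>skew_fps R \<alpha>\<^esub> skew_fps_const R r =
    skew_fps_const R (\<alpha> r) \<otimes>\<^bsub>skew_fps R \<alpha>\<^esub> skew_fps_X R"
proof
  fix n
  have z: "(\<alpha> ^^ i) \<zero> = \<zero>" for i by (rule hom_zero_finsum[OF hom_funpow[OF \<alpha>]])
  have ar: "\<alpha> r \<in> carrier R" using ring_hom_closed[OF \<alpha> r] .
  have "(skew_fps_X R \<otimes>\<^bsub>skew_fps R \<alpha>\<^esub> skew_fps_const R r) n = (if n = 1 then \<alpha> r else \<zero>)"
  proof (cases "n = 0")
    case True
    then show ?thesis by (simp add: skew_fps_def skew_fps_X_def skew_fps_const_def r)
  next
    case False
    then show ?thesis
      using skew_fps_finsum_single[of 1 n "\<lambda>i. (if i = 1 then \<one> else \<zero>) \<otimes>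
          (\<alpha> ^^ i) (if n - i = 0 then r else \<zero>)"] z[of 1] ar
        ring_hom_closed[OF hom_funpow[OF \<alpha>] r] 
      by (auto simp: skew_fps_def skew_fps_X_def skew_fps_const_def z)
  qed
  moreover have "(skew_fps_const R (\<alpha> r) \<otimes>\<^bsub>skew_fps R \<alpha>\<^esub> skew_fps_X R) n =
      (if n = 1 then \<alpha> r else \<zero>)"
    using skew_fps_finsum_single[of 0 n "\<lambda>i. (if i = 0 then \<alpha> r else \<zero>) \<otimes>
        (\<alpha> ^^ i) (if n - i = 1 then \<one> else \<zero>)"] ar z
      ring_hom_closed[OF hom_funpow[OF \<alpha>]]
    by (auto simp: skew_fps_def skew_fps_X_def skew_fps_const_def)
  ultimately show "(skew_fps_X R \<otimes>\<^bsub>skew_fps R \<alpha>\<^esub> skew_fps_const R r) n =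
      (skew_fps_const R (\<alpha> r) \<otimes>\<^bsub>skew_fps R \<alpha>\<^esub> skew_fps_X R) n" by simp
qed

end

end

theory Submission
  imports Defs
begin

text \<open>
  A skew power series is a unit iff its constant term is: a right inverse is found by solving for
  its coefficients one at a time, and its constant term is again a unit. Hence the units,
  \<open>\<Delta>\<close>, and \<open>\<plusminus>1 + \<Delta>\<close> of \<open>R[[x;\<alpha>]]\<close> are the preimages
  of those of \<open>R\<close> under the surjection \<open>f \<mapsto> f 0\<close>.
\<close>

lemma skew_fps_carrier_iff: "f \<in> carrier (skew_fps R \<alpha>) \<longleftrightarrow> (\<forall>n. f n \<in> carrier R)"
  by (auto simp: skew_fps_def)

lemma skew_fps_zero_nth: "\<zero>\<^bsub>skew_fps R \<alpha>\<^esub> n = \<zero>\<^bsub>R\<^esub>"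
  by (simp add: skew_fps_def)

lemma skew_fps_one_nth:
  "\<one>\<^bsub>skew_fps R \<alpha>\<^esub> n = (if n = 0 then \<one>\<^bsub>R\<^esub> else \<zero>\<^bsub>R\<^esub>)"
  by (simp add: skew_fps_def)

lemma skew_fps_add_nth: "(f \<oplus>\<^bsub>skew_fps R \<alpha>\<^esub> g) n = f n \<oplus>\<^bsub>R\<^esub> g n"
  by (simp add: skew_fps_def)

lemma skew_fps_mult_nth:
  "(f \<otimes>\<^bsub>skew_fps R \<alpha>\<^esub> g) n =
    (\<Oplus>\<^bsub>R\<^esub>i\<in>{..n}. f i \<otimes>\<^bsub>R\<^esub> (\<alpha> ^^ i) (g (n - i)))"
  by (simp add: skew_fps_def)

context ring
begin

text \<open>Only the index 0 contributes, and \<open>\<alpha> ^^ 0\<close> is the identity. This is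
  what carries inverses from series down to constant terms.\<close>

lemma skew_fps_mult_nth_0:
  assumes "f \<in> carrier (skew_fps R \<alpha>)" "g \<in> carrier (skew_fps R \<alpha>)"
  shows "(f \<otimes>\<^bsub>skew_fps R \<alpha>\<^esub> g) 0 = f 0 \<otimes> g 0"
  using assms by (simp add: skew_fps_mult_nth skew_fps_carrier_iff)

text \<open>The record \<open>skew_fps\<close> fixes no negation: \<open>\<ominus>\<close> is the
  inverse in its additive group, so it is identified through uniqueness of additive inverses in
  \<open>R\<close>.\<close>

lemma skew_fps_uminus_nth:
  assumes "\<alpha> \<in> ring_hom R R" "f \<in> carrier (skew_fps R \<alpha>)"
  shows "(\<ominus>\<^bsub>skew_fps R \<alpha>\<^esub> f) n = \<ominus> f n"
proof -
  interpret S: ring "skew_fps R \<alpha>" by (rule ring_skew_fps) fact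
  have "(\<ominus>\<^bsub>skew_fps R \<alpha>\<^esub> f \<oplus>\<^bsub>skew_fps R \<alpha>\<^esub> f) n = \<zero>"
    using assms(2) by (simp add: S.l_neg skew_fps_zero_nth)
  moreover have "(\<ominus>\<^bsub>skew_fps R \<alpha>\<^esub> f) n \<in> carrier R" "f n \<in> carrier R"
    using assms(2) S.a_inv_closed[OF assms(2)] by (simp_all add: skew_fps_carrier_iff)
  ultimately show ?thesis
    by (metis skew_fps_add_nth minus_equality)
qed

lemma skew_fps_const_closed:
  "r \<in> carrier R \<Longrightarrow> skew_fps_const R r \<in> carrier (skew_fps R \<alpha>)"
  by (simp add: skew_fps_carrier_iff skew_fps_const_def)

text \<open>In degree \<open>n\<close> of the product, the unknown \<open>g n\<close> occurs only in
  the term \<open>i = 0\<close>, untouched by \<alpha> and multiplied by \<open>f 0\<close>; the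
  other terms involve earlier coefficients only. Since \<open>f 0\<close> is a unit, the equation
  can be solved for \<open>g n\<close>.\<close>

lemma skew_fps_right_inverse:
  assumes \<alpha>: "\<alpha> \<in> ring_hom R R" and f: "f \<in> carrier (skew_fps R \<alpha>)" and u: "f 0 \<in> Units R"
  obtains g where "g \<in> carrier (skew_fps R \<alpha>)"
    "f \<otimes>\<^bsub>skew_fps R \<alpha>\<^esub> g = \<one>\<^bsub>skew_fps R \<alpha>\<^esub>"
proof -
  have cl: "(\<alpha> ^^ i) r \<in> carrier R" if "r \<in> carrier R" for r i
    using ring_hom_closed[OF hom_funpow[OF \<alpha>] that] .
  have fc: "f n \<in> carrier R" for n using f by (simp add: skew_fps_carrier_iff)
  define e where "e n = (if n = 0 then \<one> else \<zero>)" for n :: nat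
  have ec: "e n \<in> carrier R" for n by (simp add: e_def)
  \<comment> \<open>The clause on the earlier coefficients makes \<open>P g n r\<close> depend on \<open>g\<close> only below \<open>n\<close>:
    \<open>finsum\<close> obeys its congruence rule only for summands in the carrier.\<close>
  define P where "P g n r \<longleftrightarrow> r \<in> carrier R \<and> (\<forall>k<n. g k \<in> carrier R) \<and>
      (\<Oplus>i\<in>{..n}. f i \<otimes> (\<alpha> ^^ i) ((g(n := r)) (n - i))) = e n" for g n r
  have "\<exists>g. \<forall>n. P g n (g n)"
  \<comment> \<open>Recursive choice along \<open><\<close>: \<open>P g n r\<close> must not see
    \<open>g\<close> from \<open>n\<close> onwards, and admissible earlier values must always leave
    some \<open>r\<close>.\<close>
  proof (rule dependent_wf_choice[where R = less_than])
    fix g h :: "nat \<Rightarrow> 'a" and n r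
    assume "\<And>z. (z, n) \<in> less_than \<Longrightarrow> g z = h z"
    then have eq: "g k = h k" if "k < n" for k using that by simp
    show "P g n r = P h n r"
    proof (cases "r \<in> carrier R \<and> (\<forall>k<n. h k \<in> carrier R)")
      case True
      have "(\<Oplus>i\<in>{..n}. f i \<otimes> (\<alpha> ^^ i) ((g(n := r)) (n - i))) =
          (\<Oplus>i\<in>{..n}. f i \<otimes> (\<alpha> ^^ i) ((h(n := r)) (n - i)))"
        by (rule finsum_cong') (use True eq in \<open>auto simp: fc cl\<close>)
      then show ?thesis using eq by (simp add: P_def)
    next
      case False
      then show ?thesis using eq by (auto simp: P_def)
    qed
  next
    fix n and g :: "nat \<Rightarrow> 'a"
    assume "\<And>y. (y, n) \<in> less_than \<Longrightarrow> P g y (g y)"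
    then have gc: "\<forall>k<n. g k \<in> carrier R" by (simp add: P_def)
    show "\<exists>r. P g n r"
    proof (cases n)
      case 0
      then show ?thesis using u
        by (intro exI[where x = "inv (f 0)"]) (simp add: P_def e_def)
    next
      case (Suc m)
      \<comment> \<open>The terms of positive index, shifted by one. They use \<open>g\<close> only
        at \<open>m - i = n - Suc i < n\<close>, so the update at \<open>n\<close> does not affect
        them; \<open>r\<close> then solves \<open>f 0 \<otimes> r = e n \<ominus> s\<close>.\<close>
      define s where "s = (\<Oplus>i\<in>{..m}. f (Suc i) \<otimes> (\<alpha> ^^ Suc i) (g (m - i)))"
      define r where "r = inv (f 0) \<otimes> (e n \<ominus> s)"
      have sc: "s \<in> carrier R"
        unfolding s_def by (rule finsum_closed)
            (use gc Suc in \<open>auto intro!: fc cl m_closed simp del: funpow.simps\<close>)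
      have rc: "r \<in> carrier R" using u sc by (simp add: r_def ec)
      have "(\<Oplus>i\<in>{..n}. f i \<otimes> (\<alpha> ^^ i) ((g(n := r)) (n - i))) =
          (\<Oplus>i\<in>{..m}. f (Suc i) \<otimes> (\<alpha> ^^ Suc i) ((g(n := r)) (n - Suc i))) \<oplus> f 0 \<otimes> r"
        unfolding Suc
        by (subst finsum_Suc2) (use gc rc Suc in \<open>auto intro!: fc cl m_closed simp del: funpow.simps\<close>)
      also have "(\<Oplus>i\<in>{..m}. f (Suc i) \<otimes> (\<alpha> ^^ Suc i) ((g(n := r)) (n - Suc i))) = s"
        unfolding s_def
        by (rule finsum_cong') (use gc Suc in \<open>auto intro!: fc cl m_closed simp del: funpow.simps\<close>)
      also have "f 0 \<otimes> r = e n \<ominus> s"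
        unfolding r_def using u sc fc by (simp add: m_assoc[symmetric] ec)
      also have "s \<oplus> (e n \<ominus> s) = e n"
        using sc by (simp add: minus_eq a_lcomm[of s "e n"] ec r_neg)
      finally show ?thesis using gc rc unfolding P_def by blast
    qed
  qed simp
  then obtain g where g: "\<And>n. P g n (g n)" by blast
  show thesis
  proof
    show "g \<in> carrier (skew_fps R \<alpha>)"
      using g by (simp add: P_def skew_fps_carrier_iff)
    \<comment> \<open>With \<open>r = g n\<close> the update \<open>g(n := r)\<close> is
      \<open>g\<close> itself, so \<open>P g n (g n)\<close> contains the equation in degree
      \<open>n\<close>.\<close>
    show "f \<otimes>\<^bsub>skew_fps R \<alpha>\<^esub> g = \<one>\<^bsub>skew_fps R \<alpha>\<^esub>"
      using g by (simp add: P_def fun_eq_iff skew_fps_mult_nth skew_fps_one_nth e_def)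
  qed
qed

text \<open>For the converse direction, a right inverse \<open>g\<close> of \<open>f\<close> has a
  right inverse \<open>h\<close> in turn, and then \<open>f = f (g h) = (f g) h = h\<close>, so that
  \<open>g\<close> is also a left inverse of \<open>f\<close>.\<close>

theorem skew_fps_Units_iff:
  assumes \<alpha>: "\<alpha> \<in> ring_hom R R" and f: "f \<in> carrier (skew_fps R \<alpha>)"
  shows "f \<in> Units (skew_fps R \<alpha>) \<longleftrightarrow> f 0 \<in> Units R"
proof
  interpret S: ring "skew_fps R \<alpha>" by (rule ring_skew_fps) fact
  have carrier_nth: "h 0 \<in> carrier R" if "h \<in> carrier (skew_fps R \<alpha>)" for h
    using that by (simp add: skew_fps_carrier_iff)
  {
    assume "f \<in> Units (skew_fps R \<alpha>)"
    then obtain g where g: "g \<in> carrier (skew_fps R \<alpha>)"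
      "g \<otimes>\<^bsub>skew_fps R \<alpha>\<^esub> f = \<one>\<^bsub>skew_fps R \<alpha>\<^esub>"
      "f \<otimes>\<^bsub>skew_fps R \<alpha>\<^esub> g = \<one>\<^bsub>skew_fps R \<alpha>\<^esub>"
      by (auto simp: Units_def)
    then have "g 0 \<otimes> f 0 = \<one>" "f 0 \<otimes> g 0 = \<one>"
      by (metis f skew_fps_mult_nth_0 skew_fps_one_nth)+
    then show "f 0 \<in> Units R"
      using carrier_nth[OF f] carrier_nth[OF g(1)] by (auto simp: Units_def)
  next
    assume u: "f 0 \<in> Units R"
    obtain g where g: "g \<in> carrier (skew_fps R \<alpha>)"
      and fg: "f \<otimes>\<^bsub>skew_fps R \<alpha>\<^esub> g = \<one>\<^bsub>skew_fps R \<alpha>\<^esub>"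
      using skew_fps_right_inverse[OF \<alpha> f u] .
    have "f 0 \<otimes> g 0 = \<one>"
      by (metis f g fg skew_fps_mult_nth_0 skew_fps_one_nth)
    \<comment> \<open>A right inverse of a unit is its two-sided inverse, so \<open>g 0\<close> is
      itself a unit and the construction applies to \<open>g\<close>.\<close>
    then have "g 0 = inv (f 0)"
      using u carrier_nth[OF g]
      by (metis Units_closed Units_inv_closed Units_l_inv inv_unique)
    then have "g 0 \<in> Units R" using u by simp
    then obtain h where h: "h \<in> carrier (skew_fps R \<alpha>)"
      and gh: "g \<otimes>\<^bsub>skew_fps R \<alpha>\<^esub> h = \<one>\<^bsub>skew_fps R \<alpha>\<^esub>"
      using skew_fps_right_inverse[OF \<alpha> g] by blast
    have "f = h" using S.inv_unique[OF fg gh] f g h by simp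
    then show "f \<in> Units (skew_fps R \<alpha>)"
      using f g fg gh by (auto simp: Units_def)
  }
qed

theorem skew_fps_Delta_iff:
  assumes \<alpha>: "\<alpha> \<in> ring_hom R R" and f: "f \<in> carrier (skew_fps R \<alpha>)"
  shows "f \<in> Delta (skew_fps R \<alpha>) \<longleftrightarrow> f 0 \<in> Delta R"
proof
  interpret S: ring "skew_fps R \<alpha>" by (rule ring_skew_fps) fact
  have f0: "f 0 \<in> carrier R" using f by (simp add: skew_fps_carrier_iff)
  note unit_iff = skew_fps_Units_iff[OF \<alpha>]
  {
    assume d: "f \<in> Delta (skew_fps R \<alpha>)"
    have "f 0 \<oplus> u \<in> Units R" if u: "u \<in> Units R" for u
    proof -
      \<comment> \<open>Every unit \<open>u\<close> of \<open>R\<close> is the constant term of a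
        unit series, so testing \<open>f\<close> against unit series tests \<open>f 0\<close>
        against all units of \<open>R\<close>.\<close>
      let ?c = "skew_fps_const R u"
      have c: "?c \<in> carrier (skew_fps R \<alpha>)" and c0: "?c 0 = u"
        using u skew_fps_const_closed[OF Units_closed] by (simp_all add: skew_fps_const_def)
      then have "?c \<in> Units (skew_fps R \<alpha>)" using u unit_iff by simp
      then have "f \<oplus>\<^bsub>skew_fps R \<alpha>\<^esub> ?c \<in> Units (skew_fps R \<alpha>)"
        using d by (simp add: Delta_def)
      then show ?thesis using f c c0 by (simp add: unit_iff skew_fps_add_nth)
    qed
    then show "f 0 \<in> Delta R" using f0 by (simp add: Delta_def)
  next
    assume d: "f 0 \<in> Delta R"
    have "f \<oplus>\<^bsub>skew_fps R \<alpha>\<^esub> v \<in> Units (skew_fps R \<alpha>)"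
      if "v \<in> Units (skew_fps R \<alpha>)" for v
      using that d f unit_iff[OF S.Units_closed[OF that]]
      by (simp add: unit_iff S.Units_closed skew_fps_add_nth Delta_def)
    then show "f \<in> Delta (skew_fps R \<alpha>)" using f by (simp add: Delta_def)
  }
qed

lemma pm_one_plus_Delta_subset: "{\<one>, \<ominus> \<one>} <+>\<^bsub>R\<^esub> Delta R \<subseteq> carrier R"
  by (rule set_add_closed) (auto simp: Delta_def)

text \<open>The summand in \<open>Delta R\<close> is forced once the sign is chosen. Without the
  existential, membership can be compared between series and constant terms by
  \<open>skew_fps_Delta_iff\<close>.\<close>

lemma mem_pm_one_plus_Delta_iff:
  assumes x: "x \<in> carrier R"
  shows "x \<in> {\<one>, \<ominus> \<one>} <+>\<^bsub>R\<^esub> Delta R \<longleftrightarrow> \<ominus> \<one> \<oplus> x \<in> Delta R \<or> \<one> \<oplus> x \<in> Delta R"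
proof -
  have *: "x = c \<oplus> d \<longleftrightarrow> d = \<ominus> c \<oplus> x" if "c \<in> carrier R" "d \<in> carrier R" for c d
    using that x by (metis a_inv_closed r_neg1 r_neg2)
  have "d \<in> Delta R \<Longrightarrow> d \<in> carrier R" for d by (simp add: Delta_def)
  then have "x \<in> {\<one>, \<ominus> \<one>} <+>\<^bsub>R\<^esub> Delta R \<longleftrightarrow>
      (\<exists>d\<in>Delta R. d = \<ominus> \<one> \<oplus> x \<or> d = \<ominus> (\<ominus> \<one>) \<oplus> x)"
    using * by (fastforce simp: set_add_def')
  then show ?thesis by auto
qed

end

theorem proposition4p2:
  fixes R :: "('a, 'm) ring_scheme" and \<alpha> :: "'a \<Rightarrow> 'a"
  assumes "ring R" and "\<alpha> \<in> ring_hom R R"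
  shows "WDeltaU (skew_fps R \<alpha>) \<longleftrightarrow> WDeltaU R"
proof -
  interpret ring R by fact
  let ?S = "skew_fps R \<alpha>"
  interpret S: ring ?S by (rule ring_skew_fps) fact
  have U: "Units ?S = {f \<in> carrier ?S. f 0 \<in> Units R}"
    using skew_fps_Units_iff[OF assms(2)] by auto
  have "f \<in> {\<one>\<^bsub>?S\<^esub>, \<ominus>\<^bsub>?S\<^esub> \<one>\<^bsub>?S\<^esub>} <+>\<^bsub>?S\<^esub> Delta ?S \<longleftrightarrow>
      f 0 \<in> {\<one>\<^bsub>R\<^esub>, \<ominus>\<^bsub>R\<^esub> \<one>\<^bsub>R\<^esub>} <+>\<^bsub>R\<^esub> Delta R" if f: "f \<in> carrier ?S" for f
  proof -
    have "f 0 \<in> carrier R" using f by (simp add: skew_fps_carrier_iff)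
    then show ?thesis
      using f assms(2) by (simp add: S.mem_pm_one_plus_Delta_iff mem_pm_one_plus_Delta_iff
          skew_fps_Delta_iff skew_fps_add_nth skew_fps_uminus_nth skew_fps_one_nth)
  qed
  then have D: "{\<one>\<^bsub>?S\<^esub>, \<ominus>\<^bsub>?S\<^esub> \<one>\<^bsub>?S\<^esub>} <+>\<^bsub>?S\<^esub> Delta ?S =
      {f \<in> carrier ?S. f 0 \<in> {\<one>\<^bsub>R\<^esub>, \<ominus>\<^bsub>R\<^esub> \<one>\<^bsub>R\<^esub>} <+>\<^bsub>R\<^esub> Delta R}"
    using S.pm_one_plus_Delta_subset by blast
  \<comment> \<open>Taking constant terms is surjective, as constant series show, so a subset of
    \<open>carrier R\<close> is determined by its preimage.\<close>
  have preimage_eq: "{f \<in> carrier ?S. f 0 \<in> A} = {f \<in> carrier ?S. f 0 \<in> B} \<longleftrightarrow> A = B"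
    if "A \<subseteq> carrier R" "B \<subseteq> carrier R" for A B
  proof
    assume eq: "{f \<in> carrier ?S. f 0 \<in> A} = {f \<in> carrier ?S. f 0 \<in> B}"
    have "r \<in> A \<longleftrightarrow> r \<in> B" if "r \<in> carrier R" for r
      using eq skew_fps_const_closed[OF that, of \<alpha>]
      by (auto simp: set_eq_iff skew_fps_const_def dest!: spec[where x = "skew_fps_const R r"])
    then show "A = B" using that by blast
  qed simp
  show ?thesis
    unfolding WDeltaU_def U D
    by (rule preimage_eq) (use pm_one_plus_Delta_subset Units_closed in blast)+
qed

end
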